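(* Let $K$ be a field of characteristic $0$, let $L\in K[z,\partial_z]$ with $d:=\mathrm{ord}_{(1,-1)}(L)\ge1$, and assume $L$ has property $(P)$. Let $f_1,\ldots,f_d$ be a $K$-basis of $V_1(L)$ (which has dimension $d$). For each positive integer $n$ let $R_n\in I_n(L)\setminus\{0\}$, and for each integer $\ell\ge0$ put $$P_{n,\ell}(z)=\bigl(R_n^*\cdot t^\ell\bigr)\big|_{t=z},\qquad Q_{n,j,\ell}(z)=\varphi_{f_j}\!\left(\frac{P_{n,\ell}(z)-P_{n,\ell}(t)}{z-t}\right)\quad(1\le j\le d),$$ and let $\Delta_n(z)$ be the determinant of the $(d+1)\times(d+1)$ matrix whose columns, indexed by $\ell=0,1,\ldots,d$, are ${}^t\bigl(P_{n,\ell}(z),Q_{n,1,\ell}(z),\ldots,Q_{n,d,\ell}(z)\bigr)$. Assume that (i) $\mathrm{ord}_{(1,-1)}(R_n)=dn$ for all positive integers $n$; (ii) $R_n$ has property $(P)$ for all positive integers $n$. Then the following are equivalent: (a) $1,f_1,\ldots,f_d$ are linearly independent over $K(z)$. (b) $\Delta_n(z)\in K^{\times}$ for all positive integers $n$.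
   Context: $K[z,\partial_z]$ is the Weyl algebra of differential operators with polynomial coefficients, acting on the field $K((1/z))$ of formal Laurent series in $1/z$. The projection $\pi:K((1/z))\to\frac1zK[[1/z]]$ removes the polynomial part. Write a nonzero operator as $L=\sum_{j=0}^m(-1)^ja_j(z)\partial_z^j$ with $a_m\neq0$, $m_j=\deg a_j$ ($\deg0=-\infty$), $a_j(z)=\sum_{i=0}^{m_j}a_{i,j}z^i$. Then $\mathrm{ord}_{(1,-1)}(L)=\max_{0\le j\le m}\{m_j-j\}$. If $d=\mathrm{ord}_{(1,-1)}(L)\ge1$, $L$ has property $(P)$ if $$\sum_{0\le j\le m,\ m_j-j=d}a_{m_j,j}\,(k+d+1)_j\ne0\quad\text{for every integer }k\ge0,$$ where $(x)_0=1$ and $(x)_j=x(x+1)\cdots(x+j-1)$. For $f=\sum_{k\ge0}f_kz^{-k-1}\in\frac1zK[[1/z]]$, $\varphi_f:K[t]\to K$ is the $K$-linear map $t^k\mapsto f_k$, extended $K[z]$-linearly to $K[z][t]$. The formal adjoint of $R=\sum_jP_j(z)\partial_z^j$ is $R^*=\sum_j(-1)^j\partial_t^jP_j(t)\in K[t,\partial_t]$, acting on $K[t]$. $V_1(L)=\{f\in\frac1zK[[1/z]]:L\cdot f\in K[z]\}$, $V_n(L)=\mathrm{Span}_K\{\pi(z^kf):0\le k\le n-1,\ f\in V_1(L)\}$, and $I_n(L)=\{R\in K[z,\partial_z]:R\cdot f\in K[z]\text{ for all }f\in V_n(L)\}$. *)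

theory Defs
  imports
    "HOL-Computational_Algebra.Formal_Laurent_Series"
    "Jordan_Normal_Form.Determinant"
begin

text \<open>
  \<^bold>\<open>The field K((1/z)).\<close>  An element is an \<open>'a fls\<close> in the variable \<open>w = 1/z\<close>, so
  \<open>fls_nth f n\<close> is the coefficient of \<open>z\<close> to the power \<open>-n\<close>, and \<open>z\<close> itself is \<open>fls_X_inv\<close>.
\<close>

definition poly_lser :: "'a::field poly \<Rightarrow> 'a fls" where
  "poly_lser p = poly (map_poly fls_const p) fls_X_inv"

definition poly_lsers :: "'a::field fls set" where
  "poly_lsers = range poly_lser"

definition rat_lser :: "'a::field fls set" where
  "rat_lser = {poly_lser p / poly_lser q | p q. q \<noteq> 0}"

definition neg_lser :: "'a::field fls set" where
  "neg_lser = {f. \<forall>n\<le>0. fls_nth f n = 0}"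

definition proj_neg :: "'a::field fls \<Rightarrow> 'a fls" where
  "proj_neg f = fps_to_fls (Abs_fps (\<lambda>n. if n = 0 then 0 else fls_nth f (int n)))"

text \<open>Since \<open>w = 1/z\<close>, the chain rule gives \<open>d/dz = -w\<^sup>2 d/dw\<close>.\<close>

definition ddz :: "'a::field fls \<Rightarrow> 'a fls" where
  "ddz f = - (fls_X ^ 2 * fls_deriv f)"

lemma fls_nth_ddz: "fls_nth (ddz f) (n + 1) = - of_int n * fls_nth f n"
  by (simp add: ddz_def fls_X_power_times_conv_shift)

definition fls_scale :: "'a::field \<Rightarrow> 'a fls \<Rightarrow> 'a fls" where
  "fls_scale c f = fls_const c * f"

interpretation lser: Vector_Spaces.vector_space "fls_scale :: 'a::field \<Rightarrow> 'a fls \<Rightarrow> 'a fls"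
  by unfold_locales
    (simp_all add: fls_scale_def algebra_simps flip: fls_plus_const)

text \<open>
  \<^bold>\<open>Differential operators.\<close>  Every element of the Weyl algebra has a unique normal form
  \<open>\<Sum>j. P\<^sub>j(z) \<partial>\<^sup>j\<close>; it is represented by the polynomial whose \<open>j\<close>-th coefficient is \<open>P\<^sub>j\<close>.
  The (commutative) product of \<open>'a poly poly\<close> is not the product of the Weyl algebra and is
  never applied to operators.
\<close>

type_synonym 'a weyl = "'a poly poly"

definition weyl_act :: "'a::field weyl \<Rightarrow> 'a fls \<Rightarrow> 'a fls" where
  "weyl_act R f = (\<Sum>j\<le>degree R. poly_lser (coeff R j) * (ddz ^^ j) f)"

text \<open>The action of the adjoint \<open>R\<^sup>* = \<Sum>j. (-1)\<^sup>j \<partial>\<^sub>t\<^sup>j P\<^sub>j(t)\<close> on \<open>K[t]\<close>: multiplication by \<open>P\<^sub>j\<close>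
  comes first, then differentiation.\<close>

definition adjoint_act :: "'a::field weyl \<Rightarrow> 'a poly \<Rightarrow> 'a poly" where
  "adjoint_act R p = (\<Sum>j\<le>degree R. (-1) ^ j * (pderiv ^^ j) (coeff R j * p))"

text \<open>The order with respect to the weight \<open>(1,-1)\<close>; meaningful for nonzero operators only.
  Restricting to nonzero coefficients implements \<open>deg 0 = -\<infinity>\<close>.\<close>

definition weyl_ord :: "'a::field weyl \<Rightarrow> int" where
  "weyl_ord L =
     Max {int (degree (coeff L j)) - int j | j. j \<le> degree L \<and> coeff L j \<noteq> 0}"

text \<open>The polynomials \<open>a\<^sub>j\<close> in \<open>L = \<Sum>j. (-1)\<^sup>j a\<^sub>j \<partial>\<^sup>j\<close>.\<close>

definition signed_coeff :: "'a::field weyl \<Rightarrow> nat \<Rightarrow> 'a poly" where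
  "signed_coeff L j = (-1) ^ j * coeff L j"

definition property_P :: "'a::field weyl \<Rightarrow> bool" where
  "property_P L \<longleftrightarrow> L \<noteq> 0 \<and> weyl_ord L \<ge> 1 \<and>
     (\<forall>k::nat.
        (\<Sum>j | j \<le> degree L \<and> signed_coeff L j \<noteq> 0 \<and>
               int (degree (signed_coeff L j)) - int j = weyl_ord L.
           lead_coeff (signed_coeff L j) *
           pochhammer (of_int (int k + weyl_ord L + 1)) j) \<noteq> 0)"

definition V1 :: "'a::field weyl \<Rightarrow> 'a fls set" where
  "V1 L = {f \<in> neg_lser. weyl_act L f \<in> poly_lsers}"

definition Vn :: "nat \<Rightarrow> 'a::field weyl \<Rightarrow> 'a fls set" where
  "Vn n L = lser.span {proj_neg (fls_X_inv ^ k * f) | k f. k < n \<and> f \<in> V1 L}"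

definition In :: "nat \<Rightarrow> 'a::field weyl \<Rightarrow> 'a weyl set" where
  "In n L = {R. \<forall>f \<in> Vn n L. weyl_act R f \<in> poly_lsers}"

text \<open>
  \<^bold>\<open>The functionals \<open>\<phi>\<^sub>f\<close>.\<close>  Elements of \<open>K[z][t]\<close> are polynomials in \<open>t\<close> (outer variable) with
  coefficients in \<open>K[z]\<close>; \<open>phi f\<close> is the \<open>K[z]\<close>-linear extension of \<open>t\<^sup>k \<mapsto> f\<^sub>k\<close>, where \<open>f\<^sub>k\<close> is
  the coefficient of \<open>z\<close> to the power \<open>-k-1\<close>.
\<close>

definition phi :: "'a::field fls \<Rightarrow> 'a poly poly \<Rightarrow> 'a poly" where
  "phi f q = (\<Sum>k\<le>degree q. Polynomial.smult (fls_nth f (int k + 1)) (coeff q k))"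

text \<open>The quotient \<open>(P(z) - P(t)) / (z - t)\<close> in \<open>K[z][t]\<close>; the division is exact.\<close>

definition diff_quot :: "'a::field poly \<Rightarrow> 'a poly poly" where
  "diff_quot P = ([:P:] - map_poly (\<lambda>c. [:c:]) P) div [:[:0, 1:], -1:]"

lemma diff_quot_exact:
  fixes P :: "'a::field poly"
  shows "[:[:0, 1:], -1:] * diff_quot P = [:P:] - map_poly (\<lambda>c. [:c:]) P"
proof -
  have "poly (map_poly (\<lambda>c. [:c:]) P) [:0, 1:] = P"
    by (induction P) (simp_all add: map_poly_pCons)
  then have "[:- [:0, 1:], 1:] dvd [:P:] - map_poly (\<lambda>c. [:c:]) P"
    by (intro poly_eq_0_iff_dvd [THEN iffD1]) simp
  moreover have "[:[:0, 1:], -1:] = - [:- [:0, 1:], 1 :: 'a poly:]"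
    by simp
  ultimately have "[:[:0, 1:], -1:] dvd [:P:] - map_poly (\<lambda>c. [:c:]) P"
    by (metis minus_dvd_iff)
  then show ?thesis
    unfolding diff_quot_def by (rule dvd_mult_div_cancel)
qed

definition pade_P :: "'a::field weyl \<Rightarrow> nat \<Rightarrow> 'a poly" where
  "pade_P R l = adjoint_act R (monom 1 l)"

definition pade_Q :: "'a::field weyl \<Rightarrow> 'a fls \<Rightarrow> nat \<Rightarrow> 'a poly" where
  "pade_Q R f l = phi f (diff_quot (pade_P R l))"

text \<open>Row \<open>0\<close> holds the \<open>P\<^sub>\<ell>\<close>, row \<open>j \<ge> 1\<close> the \<open>Q\<^sub>j\<^sub>,\<^sub>\<ell>\<close>; columns are indexed by \<open>\<ell>\<close>.\<close>

definition pade_det :: "nat \<Rightarrow> 'a::field weyl \<Rightarrow> (nat \<Rightarrow> 'a fls) \<Rightarrow> 'a poly" where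
  "pade_det d R f =
     det (mat (d + 1) (d + 1) (\<lambda>(i, l). if i = 0 then pade_P R l else pade_Q R (f i) l))"

text \<open>Linear independence over \<open>K(z)\<close> of the family \<open>1, f\<^sub>1, \<dots>, f\<^sub>d\<close>, with \<open>K(z)\<close> viewed as a
  subfield of \<open>K((1/z))\<close>.\<close>

definition lin_indep_one_over_Kz :: "nat \<Rightarrow> (nat \<Rightarrow> 'a::field fls) \<Rightarrow> bool" where
  "lin_indep_one_over_Kz d f \<longleftrightarrow>
     (\<forall>c. (\<forall>j\<le>d. c j \<in> rat_lser) \<and> c 0 + (\<Sum>j=1..d. c j * f j) = 0
          \<longrightarrow> (\<forall>j\<le>d. c j = 0))"

end

theory Submission
  imports Defs
begin

text \<open>
  The residue pairing \<open>\<langle>f, p\<rangle>\<close>, the coefficient of \<open>1/z\<close> in \<open>p f\<close>, computes \<open>\<phi>\<^sub>f\<close> on \<open>K[t]\<close> for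
  \<open>f\<close> without polynomial part. Since a derivative has no residue, the formal adjoint is the
  adjoint for this pairing (\<open>res_pairing_weyl_act\<close>). Hence \<open>R\<^sub>n \<in> I\<^sub>n(L)\<close> means that
  every \<open>P\<^sub>n\<^sub>,\<^sub>\<ell>\<close> is orthogonal to \<open>z\<^sup>k f\<^sub>j\<close> for \<open>k < n\<close> (\<open>In_orthogonal\<close>), and therefore that the
  remainders \<open>Q\<^sub>n\<^sub>,\<^sub>j\<^sub>,\<^sub>\<ell> - P\<^sub>n\<^sub>,\<^sub>\<ell> f\<^sub>j\<close> have order at least \<open>n+1\<close> in \<open>1/z\<close>. Property \<open>(P)\<close> gives the
  degree \<open>dn + \<ell>\<close> of \<open>P\<^sub>n\<^sub>,\<^sub>\<ell>\<close> (\<open>degree_pade_P\<close>).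

  Subtracting \<open>f\<^sub>j\<close> times the first row turns the rows of the \<open>Q\<^sub>n\<^sub>,\<^sub>j\<^sub>,\<^sub>\<ell>\<close> into rows of remainders.
  Comparing orders, the polynomial \<open>\<Delta>\<^sub>n\<close> has no positive powers of \<open>z\<close>; it is always a constant,
  namely the determinant of the matrix of leading terms (\<open>det_pade_eq_const\<close>). The question is
  only whether this constant vanishes.

  If it vanishes for some \<open>n\<close>, a kernel vector of the matrix of leading terms yields a nonzero
  combination of \<open>P\<^sub>n\<^sub>,\<^sub>0, \<dots>, P\<^sub>n\<^sub>,\<^sub>d\<close> of degree less than \<open>d(n+1)\<close> that satisfies all \<open>d(n+1)\<close>
  orthogonality relations of level \<open>n + 1\<close>. These relations, restricted to polynomials of degree
  less than \<open>d(n+1)\<close>, then form a singular square system, so some combination of them vanishes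
  on all such polynomials. It vanishes also on the \<open>P\<^sub>n\<^sub>+\<^sub>1\<^sub>,\<^sub>\<ell>\<close>, whose degrees are all the integers
  from \<open>d(n+1)\<close> on, hence on \<open>K[t]\<close>. A combination of the \<open>z\<^sup>k f\<^sub>j\<close> that pairs to zero with
  \<open>K[t]\<close> is a polynomial, and this is a \<open>K(z)\<close>-linear relation between \<open>1, f\<^sub>1, \<dots>, f\<^sub>d\<close>
  (\<open>orthogonal_low_degree_eq_0\<close>).

  Conversely, let \<open>c\<^sub>0, \<dots>, c\<^sub>d\<close> be the polynomial coefficients of such a relation. Applied to the
  rows of the determinant, they give polynomials \<open>c\<^sub>0 P\<^sub>n\<^sub>,\<^sub>\<ell> + \<Sum>\<^sub>j c\<^sub>j Q\<^sub>n\<^sub>,\<^sub>j\<^sub>,\<^sub>\<ell>\<close> which are also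
  combinations of remainders; as soon as \<open>n\<close> exceeds the degrees of the \<open>c\<^sub>j\<close>, they have only
  negative powers of \<open>z\<close> and vanish, so \<open>\<Delta>\<^sub>n = 0\<close> (\<open>pade_relation_det_eq_0\<close>).
\<close>

section \<open>Polynomials inside the field of Laurent series\<close>

lemma poly_lser_0 [simp]: "poly_lser 0 = 0"
  by (simp add: poly_lser_def)

lemma poly_lser_pCons: "poly_lser (pCons a p) = fls_const a + fls_X_inv * poly_lser p"
  by (simp add: poly_lser_def map_poly_pCons)

lemma fls_nth_poly_lser:
  "fls_nth (poly_lser p) m = (if m \<le> 0 then coeff p (nat (- m)) else 0)"
proof (induction p arbitrary: m)
  case (pCons a p)
  then show ?case
    by (auto simp: poly_lser_pCons fls_X_inv_times_conv_shift coeff_pCons nat_diff_distrib'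
        split: nat.split intro!: arg_cong[where f = "coeff p"])
qed simp

lemma poly_lser_add: "poly_lser (p + q) = poly_lser p + poly_lser q"
  by (intro fls_eqI) (simp add: fls_nth_poly_lser)

lemma poly_lser_smult: "poly_lser (Polynomial.smult a p) = fls_const a * poly_lser p"
  by (intro fls_eqI) (simp add: fls_nth_poly_lser)

lemma poly_lser_mult: "poly_lser (p * q) = poly_lser p * poly_lser q"
  by (induction p)
    (simp_all add: poly_lser_add poly_lser_smult poly_lser_pCons algebra_simps)

interpretation poly_lser: inj_comm_ring_hom "poly_lser :: 'a::field poly \<Rightarrow> 'a fls"
proof unfold_locales
  show "poly_lser 1 = 1"
    by (simp add: one_pCons poly_lser_pCons)
  fix p :: "'a poly"
  show "p = 0" if "poly_lser p = 0"
  proof (rule poly_eqI)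
    fix n
    show "coeff p n = coeff 0 n"
      using arg_cong[OF that, of "\<lambda>f. fls_nth f (- int n)"] by (simp add: fls_nth_poly_lser)
  qed
qed (auto simp: poly_lser_add poly_lser_mult)

lemma poly_lser_monom: "poly_lser (monom c k) = fls_const c * fls_X_inv ^ k"
  by (induction k) (simp_all add: monom_0 monom_Suc poly_lser_pCons)

lemma poly_lsers_iff: "f \<in> poly_lsers \<longleftrightarrow> (\<forall>m>0. fls_nth f m = 0)"
proof
  assume "f \<in> poly_lsers"
  then show "\<forall>m>0. fls_nth f m = 0"
    by (auto simp: poly_lsers_def fls_nth_poly_lser)
next
  assume pos: "\<forall>m>0. fls_nth f m = 0"
  define p where "p = (\<Sum>k\<le>nat (- fls_subdegree f). monom (fls_nth f (- int k)) k)"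
  have coeff_p: "coeff p k = fls_nth f (- int k)" for k
  proof (cases "k \<le> nat (- fls_subdegree f)")
    case True
    then show ?thesis by (simp add: p_def coeff_sum)
  next
    case False
    then have "- int k < fls_subdegree f" by linarith
    with False show ?thesis by (simp add: p_def coeff_sum)
  qed
  have "f = poly_lser p"
    by (intro fls_eqI) (use pos in \<open>auto simp: fls_nth_poly_lser coeff_p\<close>)
  then show "f \<in> poly_lsers" by (auto simp: poly_lsers_def)
qed

lemma fls_nth_poly_lser_mult:
  assumes "degree p \<le> N"
  shows "fls_nth (poly_lser p * g) m = (\<Sum>k\<le>N. coeff p k * fls_nth g (m + int k))"
proof -
  have "poly_lser p = (\<Sum>k\<le>N. fls_const (coeff p k) * fls_X_inv ^ k)"
    by (subst poly_as_sum_of_monoms'[OF assms, symmetric])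
      (simp only: poly_lser.hom_sum poly_lser_monom)
  then show ?thesis
    by (simp add: sum_distrib_right fls_nth_sum mult.assoc fls_X_inv_power_times_conv_shift(1))
qed

section \<open>The residue pairing\<close>

text \<open>
  On \<open>neg_lser\<close> this is the functional \<open>\<phi>\<^sub>f\<close> on \<open>K[t]\<close>. Allowing an arbitrary Laurent series \<open>f\<close>
  makes the pairing compatible with multiplication by \<open>z\<close> and with \<open>ddz\<close>, without projections.
\<close>

definition res_pairing :: "'a::field fls \<Rightarrow> 'a poly \<Rightarrow> 'a" where
  "res_pairing f p = fls_nth (poly_lser p * f) 1"

lemma res_pairing_altdef:
  "degree p \<le> N \<Longrightarrow> res_pairing f p = (\<Sum>k\<le>N. coeff p k * fls_nth f (int k + 1))"
  by (simp add: res_pairing_def fls_nth_poly_lser_mult add.commute)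

lemma res_pairing_add: "res_pairing f (p + q) = res_pairing f p + res_pairing f q"
  by (simp add: res_pairing_def poly_lser_add algebra_simps)

lemma res_pairing_smult: "res_pairing f (Polynomial.smult a p) = a * res_pairing f p"
  by (simp add: res_pairing_def poly_lser_smult mult.assoc)

lemma res_pairing_sum: "res_pairing f (\<Sum>i\<in>I. p i) = (\<Sum>i\<in>I. res_pairing f (p i))"
  by (simp add: res_pairing_def poly_lser.hom_sum sum_distrib_right fls_nth_sum)

lemma res_pairing_monom_mult:
  "res_pairing f (monom 1 k * p) = fls_nth (poly_lser p * f) (int k + 1)"
proof -
  have "poly_lser (monom 1 k * p) * f = fls_X_inv ^ k * (poly_lser p * f)"
    by (simp add: poly_lser_mult poly_lser_monom mult.assoc)
  then show ?thesis
    by (simp add: res_pairing_def fls_X_inv_power_times_conv_shift(1) add.commute)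
qed

lemma res_pairing_poly_lsers: "f \<in> poly_lsers \<Longrightarrow> res_pairing f p = 0"
  by (simp add: poly_lsers_iff res_pairing_altdef[OF order.refl])

lemma res_pairing_proj_neg: "res_pairing (proj_neg f) p = res_pairing f p"
  by (simp add: res_pairing_altdef[OF order.refl] proj_neg_def nat_add_distrib add.commute)

section \<open>Adjointness\<close>

lemma ddz_mult: "ddz (f * g) = ddz f * g + f * ddz g"
  by (simp add: ddz_def algebra_simps)

lemma ddz_poly_lser: "ddz (poly_lser p) = poly_lser (pderiv p)"
proof (intro fls_eqI)
  fix m :: int
  have "fls_nth (ddz (poly_lser p)) m = - of_int (m - 1) * fls_nth (poly_lser p) (m - 1)"
    using fls_nth_ddz[of "poly_lser p" "m - 1"] by simp
  also have "\<dots> = fls_nth (poly_lser (pderiv p)) m"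
  proof (cases "m \<le> 0")
    case True
    then obtain k where "m = - int k"
      by (metis minus_minus nonneg_int_cases neg_0_le_iff_le)
    then show ?thesis
      by (simp add: fls_nth_poly_lser coeff_pderiv nat_add_distrib algebra_simps)
  next
    case False
    then show ?thesis by (cases "m = 1") (simp_all add: fls_nth_poly_lser)
  qed
  finally show "fls_nth (ddz (poly_lser p)) m = fls_nth (poly_lser (pderiv p)) m" .
qed

text \<open>Integration by parts: the boundary term is the residue of a derivative, which is zero.\<close>

lemma res_pairing_ddz: "res_pairing (ddz f) p = - res_pairing f (pderiv p)"
proof -
  have "fls_nth (ddz (poly_lser p * f)) 1 = 0"
    using fls_nth_ddz[of "poly_lser p * f" 0] by simp
  then show ?thesis
    by (simp add: ddz_mult ddz_poly_lser res_pairing_def eq_neg_iff_add_eq_0 add.commute)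
qed

lemma res_pairing_higher_ddz:
  "res_pairing ((ddz ^^ j) f) p = (-1) ^ j * res_pairing f ((pderiv ^^ j) p)"
  by (induction j arbitrary: p) (simp_all add: res_pairing_ddz flip: funpow_swap1)

lemma coeff_minus_one_power_mult: "coeff ((-1) ^ j * p) m = (-1) ^ j * coeff (p :: 'a::comm_ring_1 poly) m"
  by (cases "even j") simp_all

lemma res_pairing_weyl_act: "res_pairing (weyl_act R f) p = res_pairing f (adjoint_act R p)"
proof -
  have "res_pairing (weyl_act R f) p =
      (\<Sum>j\<le>degree R. res_pairing ((ddz ^^ j) f) (coeff R j * p))"
    by (simp add: res_pairing_def weyl_act_def sum_distrib_left fls_nth_sum poly_lser_mult
        mult_ac)
  also have "\<dots> = (\<Sum>j\<le>degree R. res_pairing f ((-1) ^ j * (pderiv ^^ j) (coeff R j * p)))"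
  proof (intro sum.cong refl)
    fix j
    have "(-1) ^ j * (pderiv ^^ j) (coeff R j * p) =
        Polynomial.smult ((-1) ^ j) ((pderiv ^^ j) (coeff R j * p))"
      by (cases "even j") simp_all
    then show "res_pairing ((ddz ^^ j) f) (coeff R j * p) =
        res_pairing f ((-1) ^ j * (pderiv ^^ j) (coeff R j * p))"
      by (simp add: res_pairing_higher_ddz res_pairing_smult)
  qed
  also have "\<dots> = res_pairing f (adjoint_act R p)"
    by (simp add: adjoint_act_def res_pairing_sum)
  finally show ?thesis .
qed

text \<open>
  A polynomial pairs to zero with every polynomial. Hence \<open>R \<cdot> g \<in> K[z]\<close> makes \<open>g\<close> orthogonal
  to the range of \<open>R\<^sup>*\<close>, by adjointness. For the generators
  \<open>\<pi>(z\<^sup>k f)\<close> of \<open>V\<^sub>n(L)\<close> the factor \<open>z\<^sup>k\<close> can be moved to the polynomial side.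
\<close>

lemma In_orthogonal:
  assumes R: "R \<in> In n L" and f: "f \<in> V1 L" and k: "k < n"
  shows "res_pairing f (monom 1 k * adjoint_act R p) = 0"
proof -
  define g where "g = proj_neg (fls_X_inv ^ k * f)"
  have "g \<in> Vn n L"
    unfolding Vn_def g_def using f k by (intro lser.span_base) blast
  with R have "weyl_act R g \<in> poly_lsers"
    by (auto simp: In_def)
  then have "res_pairing g (adjoint_act R p) = 0"
    by (metis res_pairing_weyl_act res_pairing_poly_lsers)
  then show ?thesis
    by (simp only: g_def res_pairing_proj_neg)
      (simp add: res_pairing_def poly_lser_mult poly_lser_monom mult_ac)
qed

section \<open>The degree of the denominators\<close>

text \<open>
  Each summand \<open>\<partial>\<^sup>j(a\<^sub>j t\<^sup>\<ell>)\<close> has degree at most \<open>D + \<ell>\<close>, and the coefficient of \<open>t\<close> to the power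
  \<open>D + \<ell>\<close> in their sum is the sum in property \<open>(P)\<close> at \<open>k = \<ell>\<close>.
\<close>

lemma degree_pade_P:
  assumes P: "property_P R" and ord: "weyl_ord R = int D"
  shows "degree (pade_P R l) = D + l"
proof (rule antisym)
  have deg: "degree (coeff R j) \<le> D + j" if "j \<le> degree R" for j
  proof (cases "coeff R j = 0")
    case False
    have "int (degree (coeff R j)) - int j \<le> weyl_ord R"
      unfolding weyl_ord_def using that False by (intro Max_ge) auto
    with ord show ?thesis by simp
  qed simp
  have coeff_P: "coeff (pade_P R l) (D + l + i) =
      (\<Sum>j\<le>degree R. (-1) ^ j * (pochhammer (of_nat (Suc (D + l + i))) j * coeff (coeff R j) (D + j + i)))"
    for i
    by (simp add: pade_P_def adjoint_act_def coeff_sum coeff_minus_one_power_mult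
        coeff_higher_pderiv mult.commute[of _ "monom _ _"] coeff_monom_mult
        flip: of_nat_Suc) (simp add: ac_simps)
  show "degree (pade_P R l) \<le> D + l"
  proof (rule degree_le, intro allI impI)
    fix m assume "D + l < m"
    then obtain i where m: "m = D + l + i" and i: "i > 0"
      by (metis less_imp_add_positive)
    show "coeff (pade_P R l) m = 0"
      unfolding m coeff_P
      by (rule sum.neutral) (use deg i in \<open>fastforce intro!: coeff_eq_0 dest: le_less_trans\<close>)
  qed
  define J where "J = {j. j \<le> degree R \<and> signed_coeff R j \<noteq> 0 \<and>
    int (degree (signed_coeff R j)) - int j = weyl_ord R}"
  have sc: "signed_coeff R j = Polynomial.smult ((-1) ^ j) (coeff R j)" for j
    by (cases "even j") (simp_all add: signed_coeff_def)
  have "coeff (pade_P R l) (D + l) =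
      (\<Sum>j\<le>degree R. (-1) ^ j * (pochhammer (of_nat (Suc (D + l))) j * coeff (coeff R j) (D + j)))"
    using coeff_P[of 0] by simp
  also have "\<dots> = (\<Sum>j\<in>J. lead_coeff (signed_coeff R j) *
           pochhammer (of_int (int l + weyl_ord R + 1)) j)"
  proof (rule sum.mono_neutral_cong_right)
    show "\<forall>j\<in>{..degree R} - J.
        (-1) ^ j * (pochhammer (of_nat (Suc (D + l))) j * coeff (coeff R j) (D + j)) = 0"
    proof
      fix j assume "j \<in> {..degree R} - J"
      then have "coeff R j = 0 \<or> degree (coeff R j) < D + j"
        using deg[of j] by (auto simp: J_def sc ord)
      then show "(-1) ^ j * (pochhammer (of_nat (Suc (D + l))) j * coeff (coeff R j) (D + j)) = 0"
        by (auto simp: coeff_eq_0)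
    qed
  next
    fix j assume "j \<in> J"
    then have "degree (coeff R j) = D + j"
      by (auto simp: J_def sc ord)
    then show "(-1) ^ j * (pochhammer (of_nat (Suc (D + l))) j * coeff (coeff R j) (D + j)) =
        lead_coeff (signed_coeff R j) * pochhammer (of_int (int l + weyl_ord R + 1)) j"
      by (simp add: sc ord add_ac mult_ac)
  qed (auto simp: J_def)
  also have "\<dots> \<noteq> 0"
    using P unfolding property_P_def J_def by blast
  finally show "D + l \<le> degree (pade_P R l)"
    by (rule le_degree)
qed

section \<open>Remainders\<close>

lemma diff_quot_0 [simp]: "diff_quot 0 = 0"
  by (simp add: diff_quot_def)

lemma diff_quot_pCons: "diff_quot (pCons a p) = pCons p (diff_quot p)"
proof -
  let ?t = "[:[:0, 1:], -1:] :: 'a poly poly"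
  have "?t * pCons p (diff_quot p) =
      Polynomial.smult p ?t + pCons 0 ([:p:] - map_poly (\<lambda>c. [:c:]) p)"
    by (simp only: mult_pCons_right diff_quot_exact)
  also have "\<dots> = [:pCons a p:] - map_poly (\<lambda>c. [:c:]) (pCons a p)"
    by (simp add: map_poly_pCons)
  also have "\<dots> = ?t * diff_quot (pCons a p)"
    by (simp only: diff_quot_exact)
  finally have "?t * diff_quot (pCons a p) = ?t * pCons p (diff_quot p)" ..
  then have "diff_quot (pCons a p) = pCons p (diff_quot p)"
    by (subst (asm) mult_cancel_left) simp
  then show ?thesis by simp
qed

lemma phi_altdef:
  "degree q \<le> N \<Longrightarrow> phi f q = (\<Sum>k\<le>N. Polynomial.smult (fls_nth f (int k + 1)) (coeff q k))"
  unfolding phi_def by (rule sum.mono_neutral_left) (auto simp: coeff_eq_0)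

text \<open>
  Passing from \<open>q\<close> to \<open>p + t q\<close> shifts the moments \<open>f\<^sub>k\<close>, that is, it multiplies \<open>f\<close> by \<open>z\<close>.
  Together with \<open>diff_quot_pCons\<close> this allows induction on the polynomial.
\<close>

lemma phi_pCons: "phi f (pCons p q) = Polynomial.smult (fls_nth f 1) p + phi (fls_X_inv * f) q"
proof -
  have "phi f (pCons p q) =
      (\<Sum>k\<le>Suc (degree q). Polynomial.smult (fls_nth f (int k + 1)) (coeff (pCons p q) k))"
    by (rule phi_altdef) (rule degree_pCons_le)
  then show ?thesis
    by (simp only: sum.atMost_Suc_shift)
      (simp add: phi_def fls_X_inv_times_conv_shift add_ac)
qed

lemma phi_cong:
  "(\<And>k. fls_nth f (int k + 1) = fls_nth g (int k + 1)) \<Longrightarrow> phi f q = phi g q"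
  by (simp add: phi_def)

definition pade_rem :: "'a::field fls \<Rightarrow> 'a poly \<Rightarrow> 'a fls" where
  "pade_rem f p = poly_lser (phi f (diff_quot p)) - poly_lser p * f"

text \<open>
  In other words, \<open>Q\<close> is the polynomial part of \<open>P f\<close>. In the induction step \<open>f\<close> is replaced by
  \<open>\<pi>(z f) = z f - f\<^sub>0\<close>, so \<open>f\<close> has to be arbitrary.
\<close>

lemma pade_rem_in_neg_lser: "f \<in> neg_lser \<Longrightarrow> pade_rem f p \<in> neg_lser"
proof (induction p arbitrary: f)
  case 0
  then show ?case by (simp add: pade_rem_def phi_def neg_lser_def)
next
  case (pCons a p)
  let ?b = "fls_nth f 1"
  define g where "g = fls_X_inv * f - fls_const ?b"
  have g: "g \<in> neg_lser"
    using pCons.prems by (auto simp: g_def neg_lser_def fls_X_inv_times_conv_shift)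
  have "phi (fls_X_inv * f) (diff_quot p) = phi g (diff_quot p)"
    by (rule phi_cong) (simp add: g_def)
  then have "pade_rem f (pCons a p) = pade_rem g p - fls_const a * f"
    by (simp add: pade_rem_def diff_quot_pCons phi_pCons poly_lser_pCons poly_lser_add
        poly_lser_smult g_def algebra_simps)
  then show ?case
    using pCons.IH[OF g] pCons.prems by (auto simp: neg_lser_def)
qed

lemma fls_nth_pade_rem:
  assumes "f \<in> neg_lser"
  shows "fls_nth (pade_rem f p) m =
    (if m \<le> 0 then 0 else - res_pairing f (monom 1 (nat (m - 1)) * p))"
proof (cases "m \<le> 0")
  case True
  then show ?thesis
    using pade_rem_in_neg_lser[OF assms, of p] by (simp add: neg_lser_def)
next
  case False
  then show ?thesis
    by (simp add: res_pairing_monom_mult pade_rem_def fls_nth_poly_lser)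
qed

section \<open>The determinant is a constant\<close>

text \<open>
  Left multiplication by the matrix \<open>U\<close> below replaces the rows of the \<open>Q\<close> by remainders
  and at the same time scales every row to order at least \<open>0\<close> in \<open>1/z\<close>: the first row by \<open>z\<close> to the
  power \<open>-(dn+d)\<close>, each of the \<open>d\<close> others by \<open>z\<close> to the power \<open>n+1\<close>. The scalings cancel in the
  determinant, so \<open>\<Delta>\<close> is a polynomial in \<open>z\<close> that is also a power series in \<open>1/z\<close>. It is
  therefore constant, and its value is obtained by setting \<open>1/z = 0\<close> in the scaled matrix.
\<close>

lemma det_pade_eq_const:
  fixes P :: "nat \<Rightarrow> 'a::field poly" and f :: "nat \<Rightarrow> 'a fls"
  assumes deg: "\<And>l. l \<le> d \<Longrightarrow> degree (P l) \<le> d * n + d"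
    and neg: "\<And>i. 1 \<le> i \<Longrightarrow> i \<le> d \<Longrightarrow> f i \<in> neg_lser"
    and orth: "\<And>i k l. 1 \<le> i \<Longrightarrow> i \<le> d \<Longrightarrow> k < n \<Longrightarrow> l \<le> d \<Longrightarrow>
      res_pairing (f i) (monom 1 k * P l) = 0"
  shows "det (mat (d + 1) (d + 1) (\<lambda>(i, l). if i = 0 then P l else phi (f i) (diff_quot (P l)))) =
    [: det (mat (d + 1) (d + 1) (\<lambda>(i, l). if i = 0 then coeff (P l) (d * n + d)
         else - res_pairing (f i) (monom 1 n * P l))) :]"
    (is "det ?M = [: det ?N :]")
proof -
  define U :: "'a fls mat" where "U = mat (d + 1) (d + 1) (\<lambda>(i, j).
    if i = j then if i = 0 then fls_X ^ (d * n + d) else fls_X_inv ^ (n + 1)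
    else if j = 0 then - (fls_X_inv ^ (n + 1) * f i) else 0)"
  define s where "s = (\<lambda>i l. if i = 0 then fls_X ^ (d * n + d) * poly_lser (P l)
    else fls_X_inv ^ (n + 1) * pade_rem (f i) (P l))"
  define B where "B = mat (d + 1) (d + 1) (\<lambda>(i, l). fls_regpart (s i l))"
  have s_neg: "fls_nth (s i l) m = 0" if "i \<le> d" "l \<le> d" "m < 0" for i l m
  proof (cases "i = 0")
    case True
    have "degree (P l) < nat (- (m - int (d * n + d)))"
      using deg[OF that(2)] that(3) by linarith
    then have "fls_nth (poly_lser (P l)) (m - int (d * n + d)) = 0"
      by (simp only: fls_nth_poly_lser coeff_eq_0 if_cancel)
    with True show ?thesis
      by (simp add: s_def fls_X_power_times_conv_shift(1) del: of_nat_add of_nat_mult)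
  next
    case False
    have "nat (m + int n) < n" if "m + int (n + 1) > 0"
      using that \<open>m < 0\<close> by linarith
    then show ?thesis
      using False that neg orth
      by (auto simp: s_def fls_X_inv_power_times_conv_shift fls_nth_pade_rem
          simp del: power_Suc)
  qed
  have s_0: "fls_nth (s i l) 0 = ?N $$ (i, l)" if "i \<le> d" "l \<le> d" for i l
  proof (cases "i = 0")
    case True
    have "fls_nth (s i l) 0 = fls_nth (poly_lser (P l)) (- int (d * n + d))"
      by (simp add: True s_def fls_X_power_times_conv_shift(1) del: of_nat_add of_nat_mult)
    also have "\<dots> = coeff (P l) (d * n + d)"
      by (simp add: fls_nth_poly_lser del: of_nat_add of_nat_mult)
    finally show ?thesis using True that by simp
  next
    case False
    with that neg show ?thesis
      by (simp add: s_def fls_X_inv_power_times_conv_shift(1) fls_nth_pade_rem del: power_Suc)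
  qed
  have reg: "fps_to_fls (fls_regpart (s i l)) = s i l" if "i \<le> d" "l \<le> d" for i l
    using s_neg[OF that] by (intro fls_eqI) auto
  have UM: "U * map_mat poly_lser ?M = map_mat fps_to_fls B"
  proof (rule eq_matI)
    fix i l
    assume "i < dim_row (map_mat fps_to_fls B)" "l < dim_col (map_mat fps_to_fls B)"
    then have il: "i \<le> d" "l \<le> d" by (auto simp: B_def)
    let ?Q = "\<lambda>j. poly_lser (if j = 0 then P l else phi (f j) (diff_quot (P l)))"
    have "(U * map_mat poly_lser ?M) $$ (i, l) = (\<Sum>j = 0..<d + 1. U $$ (i, j) * ?Q j)"
      using il by (simp add: U_def scalar_prod_def)
    also have "\<dots> = (\<Sum>j\<in>{0, i}. U $$ (i, j) * ?Q j)"
      using il by (intro sum.mono_neutral_right) (auto simp: U_def)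
    also have "\<dots> = s i l"
      using il by (cases "i = 0") (simp_all add: U_def s_def pade_rem_def algebra_simps)
    also have "\<dots> = map_mat fps_to_fls B $$ (i, l)"
      using il by (simp add: B_def reg)
    finally show "(U * map_mat poly_lser ?M) $$ (i, l) = map_mat fps_to_fls B $$ (i, l)" .
  qed (simp_all add: U_def B_def)
  have det_U: "det U = 1"
  proof -
    have "det U = prod_list (diag_mat U)"
      by (rule det_lower_triangular[of "d + 1"]) (auto simp: U_def)
    also have "\<dots> = (\<Prod>i = 0..<Suc d. if i = 0 then fls_X ^ (d * n + d) else fls_X_inv ^ (n + 1))"
      by (simp add: prod_list_diag_prod U_def)
    also have "\<dots> = fls_X ^ (d * n + d) * fls_X_inv ^ ((n + 1) * d)"
      by (simp only: prod.atLeast0_lessThan_Suc_shift) (simp flip: power_mult del: power_Suc)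
    also have "\<dots> = 1"
      by (simp add: fls_X_power_times_conv_shift fls_X_inv_power_conv_shift_1 algebra_simps)
    finally show ?thesis .
  qed
  interpret reg: comm_ring_hom "fps_to_fls :: 'a fps \<Rightarrow> 'a fls"
    by unfold_locales (simp_all add: fls_times_fps_to_fls)
  interpret nth0: comm_ring_hom "\<lambda>g. fps_nth g 0 :: 'a"
    by unfold_locales simp_all
  have "poly_lser (det ?M) = det (map_mat poly_lser ?M)"
    by (rule poly_lser.hom_det[symmetric])
  also have "\<dots> = det (U * map_mat poly_lser ?M)"
    by (subst det_mult[of _ "d + 1"]) (simp_all add: det_U, simp add: U_def)
  also have "\<dots> = fps_to_fls (det B)"
    by (simp only: UM reg.hom_det)
  finally have det_eq: "poly_lser (det ?M) = fps_to_fls (det B)" .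
  have "coeff (det ?M) k = 0" if "k > 0" for k
    using arg_cong[OF det_eq, of "\<lambda>g. fls_nth g (- int k)"] that by (simp add: fls_nth_poly_lser)
  moreover have "coeff (det ?M) 0 = det ?N"
  proof -
    have "coeff (det ?M) 0 = fps_nth (det B) 0"
      using arg_cong[OF det_eq, of "\<lambda>g. fls_nth g 0"] by (simp add: fls_nth_poly_lser)
    also have "\<dots> = det (map_mat (\<lambda>g. fps_nth g 0) B)"
      by (rule nth0.hom_det[symmetric])
    also have "map_mat (\<lambda>g. fps_nth g 0) B = ?N"
      by (rule eq_matI) (simp_all add: B_def s_0 del: index_mat(1), auto simp: s_0)
    finally show ?thesis .
  qed
  ultimately show ?thesis
    by (intro poly_eqI) (auto simp: coeff_pCons split: nat.split)
qed

section \<open>Linear independence over the rational functions\<close>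

lemma poly_lser_in_rat_lser: "poly_lser p \<in> rat_lser"
  unfolding rat_lser_def by (rule CollectI, rule exI[of _ p], rule exI[of _ 1]) simp

text \<open>The denominators are cleared by multiplication by their product.\<close>

lemma lin_indep_one_over_Kz_iff_poly:
  "lin_indep_one_over_Kz d f \<longleftrightarrow>
     (\<forall>c. poly_lser (c 0) + (\<Sum>j=1..d. poly_lser (c j) * f j) = 0 \<longrightarrow> (\<forall>j\<le>d. c j = 0))"
    (is "_ \<longleftrightarrow> ?R")
proof
  assume indep: "lin_indep_one_over_Kz d f"
  show ?R
  proof (intro allI impI)
    fix c j
    assume "poly_lser (c 0) + (\<Sum>j=1..d. poly_lser (c j) * f j) = 0" and "j \<le> d"
    moreover from this have "\<forall>j\<le>d. poly_lser (c j) = 0"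
      by (intro indep[unfolded lin_indep_one_over_Kz_def,
            THEN spec[of _ "\<lambda>j. poly_lser (c j)"], THEN mp] conjI allI impI poly_lser_in_rat_lser)
    ultimately have "poly_lser (c j) = 0"
      by blast
    then show "c j = 0" by simp
  qed
next
  assume R: ?R
  show "lin_indep_one_over_Kz d f"
    unfolding lin_indep_one_over_Kz_def
  proof (intro allI impI)
    fix c j
    assume c: "(\<forall>j\<le>d. c j \<in> rat_lser) \<and> c 0 + (\<Sum>j=1..d. c j * f j) = 0" and "j \<le> d"
    have "\<exists>x. c j = poly_lser (fst x) / poly_lser (snd x) \<and> snd x \<noteq> 0" if "j \<le> d" for j
    proof -
      have "c j \<in> rat_lser" using c that by simp
      then obtain p q where "c j = poly_lser p / poly_lser q" "q \<noteq> 0"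
        unfolding rat_lser_def by blast
      then show ?thesis by (intro exI[of _ "(p, q)"]) simp
    qed
    then have "\<forall>j\<in>{..d}. \<exists>x. c j = poly_lser (fst x) / poly_lser (snd x) \<and> snd x \<noteq> 0"
      by simp
    from bchoice[OF this] obtain x where
      x: "\<forall>j\<in>{..d}. c j = poly_lser (fst (x j)) / poly_lser (snd (x j)) \<and> snd (x j) \<noteq> 0"
      by blast
    define p q where "p j = fst (x j)" and "q j = snd (x j)" for j
    have pq: "c j = poly_lser (p j) / poly_lser (q j)" "q j \<noteq> 0" if "j \<le> d" for j
      using x that by (simp_all add: p_def q_def)
    define b where "b j = p j * (\<Prod>i\<in>{..d} - {j}. q i)" for j
    define e where "e = (\<Prod>i\<le>d. q i)"
    have e: "e \<noteq> 0" using pq(2) by (simp add: e_def)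
    have b: "poly_lser (b j) = poly_lser e * c j" if "j \<le> d" for j
    proof -
      have "e = q j * (\<Prod>i\<in>{..d} - {j}. q i)"
        unfolding e_def using that by (intro prod.remove) auto
      then show ?thesis
        using pq[OF that] by (simp add: b_def poly_lser_mult)
    qed
    have "poly_lser (b 0) + (\<Sum>j=1..d. poly_lser (b j) * f j) =
        poly_lser e * (c 0 + (\<Sum>j=1..d. c j * f j))"
      by (simp add: b distrib_left sum_distrib_left mult.assoc)
    also have "\<dots> = 0" using c by simp
    finally have "\<forall>j\<le>d. b j = 0"
      by (rule R[THEN spec[of _ b], THEN mp])
    then have "b j = 0" using \<open>j \<le> d\<close> by blast
    then show "c j = 0" using b[OF \<open>j \<le> d\<close>] e by simp
  qed
qed

section \<open>Uniqueness of low-degree orthogonal polynomials\<close>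

text \<open>
  The monomials of degree less than \<open>D\<close> and the \<open>S\<^sub>l\<close> have every degree exactly once, so they
  span \<open>K[t]\<close>.
\<close>

lemma res_pairing_eq_0_of_spanning_degrees:
  fixes S :: "nat \<Rightarrow> 'a::field poly"
  assumes deg: "\<And>l. degree (S l) = D + l" and nz: "\<And>l. S l \<noteq> 0"
    and low: "\<And>m. m < D \<Longrightarrow> res_pairing g (monom 1 m) = 0"
    and S: "\<And>l. res_pairing g (S l) = 0"
  shows "res_pairing g p = 0"
proof (induction "degree p" arbitrary: p rule: less_induct)
  case less
  show ?case
  proof (cases "degree p < D")
    case True
    have "res_pairing g (\<Sum>i\<le>degree p. Polynomial.smult (coeff p i) (monom 1 i)) = 0"
      unfolding res_pairing_sum res_pairing_smult using True low by simp
    then show ?thesis by (simp add: smult_monom poly_as_sum_of_monoms)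
  next
    case False
    then obtain l where l: "degree p = D + l" by (metis le_add_diff_inverse not_le)
    define a where "a = lead_coeff p / lead_coeff (S l)"
    define r where "r = p - Polynomial.smult a (S l)"
    have p_eq: "p = r + Polynomial.smult a (S l)" by (simp add: r_def)
    have "degree r \<le> D + l"
      unfolding r_def using l deg[of l] by (intro degree_diff_le) (auto intro: degree_smult_le[THEN order_trans])
    moreover have "coeff r (D + l) = 0"
    proof -
      have "coeff p (D + l) = lead_coeff p" "coeff (S l) (D + l) = lead_coeff (S l)"
        by (simp_all add: l deg)
      moreover have "lead_coeff (S l) \<noteq> 0" using nz[of l] by simp
      ultimately show ?thesis by (simp only: r_def a_def coeff_diff coeff_smult) simp
    qed
    ultimately have "r = 0 \<or> degree r < degree p"
      using l by (metis le_neq_implies_less leading_coeff_0_iff)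
    then have "res_pairing g r = 0"
      using less by (auto simp: res_pairing_def)
    then show ?thesis
      by (subst p_eq) (simp add: res_pairing_add res_pairing_smult S)
  qed
qed

text \<open>
  There are as many relations \<open>\<langle>f\<^sub>i, t\<^sup>k p\<rangle> = 0\<close> as there are coefficients of \<open>p\<close>, namely \<open>dN\<close>. A
  nonzero solution makes the square matrix of this system singular, hence also its transpose, and a
  kernel vector of the transpose is a combination \<open>g = \<Sum>\<^sub>i c\<^sub>i f\<^sub>i\<close> with polynomials \<open>c\<^sub>i\<close> of degree
  less than \<open>N\<close> that is orthogonal to all monomials of degree less than \<open>dN\<close>. The polynomials
  \<open>S\<^sub>l\<close> take care of all higher degrees, so \<open>g\<close> is a polynomial, contradicting independence.
\<close>

lemma orthogonal_low_degree_eq_0: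
  fixes f :: "nat \<Rightarrow> 'a::field fls"
  assumes indep: "lin_indep_one_over_Kz d f"
    and deg: "\<And>l. degree (S l) = d * N + l" and nz: "\<And>l. S l \<noteq> 0"
    and S: "\<And>i k l. 1 \<le> i \<Longrightarrow> i \<le> d \<Longrightarrow> k < N \<Longrightarrow> res_pairing (f i) (monom 1 k * S l) = 0"
    and p: "\<And>i k. 1 \<le> i \<Longrightarrow> i \<le> d \<Longrightarrow> k < N \<Longrightarrow> res_pairing (f i) (monom 1 k * p) = 0"
    and degp: "degree p < d * N"
  shows "p = 0"
proof (rule ccontr)
  assume "p \<noteq> 0"
  define D where "D = d * N"
  have d: "d > 0" using degp by (cases d) auto
  have div: "r div d < N" if "r < D" for r
    using that by (simp add: D_def less_mult_imp_div_less mult.commute)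
  \<comment> \<open>The index \<open>r < D\<close> encodes the pair of the exponent \<open>k = r div d\<close> and the series with number
    \<open>i = r mod d + 1\<close>.\<close>
  define F where "F r = f (r mod d + 1)" for r
  have F: "\<exists>i. 1 \<le> i \<and> i \<le> d \<and> F r = f i" for r
    using d by (intro exI[of _ "r mod d + 1"]) (simp add: F_def Suc_le_eq)
  define A where "A = mat D D (\<lambda>(r, m). res_pairing (F r) (monom 1 (r div d + m)))"
  have A: "A \<in> carrier_mat D D" by (simp add: A_def)
  have "A *\<^sub>v vec D (coeff p) = 0\<^sub>v D"
  proof (rule eq_vecI)
    fix r assume r: "r < dim_vec (0\<^sub>v D :: 'a vec)"
    have "(A *\<^sub>v vec D (coeff p)) $ r =
        (\<Sum>m<D. res_pairing (F r) (monom 1 (r div d + m)) * coeff p m)"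
      using r by (simp add: A_def scalar_prod_def atLeast0LessThan)
    also have "\<dots> = res_pairing (F r) (\<Sum>m<D. monom 1 (r div d) * monom (coeff p m) m)"
      unfolding res_pairing_sum
      by (intro sum.cong refl) (simp add: mult_monom mult.commute flip: res_pairing_smult
          , simp add: smult_monom)
    also have "(\<Sum>m<D. monom 1 (r div d) * monom (coeff p m) m) = monom 1 (r div d) * p"
    proof -
      have "(\<Sum>m\<le>D - 1. monom (coeff p m) m) = p"
        using degp by (intro poly_as_sum_of_monoms') (simp add: D_def)
      moreover have "{..D - 1} = {..<D}"
        using degp by (auto simp: D_def)
      ultimately show ?thesis by (simp flip: sum_distrib_left)
    qed
    also have "res_pairing (F r) (monom 1 (r div d) * p) = 0"
      using F[of r] p div r by auto
    finally show "(A *\<^sub>v vec D (coeff p)) $ r = 0\<^sub>v D $ r" using r by simp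
  qed (simp add: A_def)
  moreover have "vec D (coeff p) \<noteq> 0\<^sub>v D"
  proof
    assume "vec D (coeff p) = 0\<^sub>v D"
    then have "vec D (coeff p) $ degree p = 0\<^sub>v D $ degree p" by simp
    with degp \<open>p \<noteq> 0\<close> show False by (simp add: D_def)
  qed
  ultimately have "det A = 0"
    using det_0_iff_vec_prod_zero[OF A] by (metis vec_carrier)
  then have "det (transpose_mat A) = 0"
    by (simp add: det_transpose[OF A])
  then obtain v where v: "v \<in> carrier_vec D" "v \<noteq> 0\<^sub>v D" "transpose_mat A *\<^sub>v v = 0\<^sub>v D"
    using det_0_iff_vec_prod_zero[of "transpose_mat A" D] A by auto
  define c where "c j = (\<Sum>r | r < D \<and> r mod d + 1 = j. monom (v $ r) (r div d))" for j
  define g where "g = (\<Sum>j=1..d. poly_lser (c j) * f j)"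
  have g_eq: "g = (\<Sum>r<D. poly_lser (monom (v $ r) (r div d)) * F r)"
  proof -
    have "g = (\<Sum>j=1..d. \<Sum>r\<in>{r \<in> {..<D}. r mod d + 1 = j}.
        poly_lser (monom (v $ r) (r div d)) * F r)"
      by (auto simp: g_def c_def poly_lser.hom_sum sum_distrib_right F_def intro!: sum.cong)
    also have "\<dots> = (\<Sum>r<D. poly_lser (monom (v $ r) (r div d)) * F r)"
      by (rule sum.group) (use d in \<open>auto simp: Suc_le_eq\<close>)
    finally show ?thesis .
  qed
  have res_g: "res_pairing g q = (\<Sum>r<D. v $ r * res_pairing (F r) (monom 1 (r div d) * q))" for q
  proof -
    have "res_pairing g q = (\<Sum>r<D. res_pairing (F r) (monom (v $ r) (r div d) * q))"
      by (simp add: g_eq res_pairing_def sum_distrib_left fls_nth_sum poly_lser_mult mult_ac)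
    then show ?thesis
      by (simp flip: res_pairing_smult mult_smult_left add: smult_monom)
  qed
  have "res_pairing g q = 0" for q
  proof (rule res_pairing_eq_0_of_spanning_degrees[of S D])
    fix m assume m: "m < D"
    have "res_pairing g (monom 1 m) = (transpose_mat A *\<^sub>v v) $ m"
      using m v(1) by (simp add: res_g A_def scalar_prod_def mult_monom atLeast0LessThan ac_simps)
    then show "res_pairing g (monom 1 m) = 0" using v(3) m by simp
  next
    fix l
    show "res_pairing g (S l) = 0"
      unfolding res_g
    proof (intro sum.neutral ballI)
      fix r assume "r \<in> {..<D}"
      then show "v $ r * res_pairing (F r) (monom 1 (r div d) * S l) = 0"
        using F[of r] S div by auto
    qed
  qed (simp_all add: deg nz D_def)
  then have "fls_nth g (int k + 1) = 0" for k
    using res_pairing_monom_mult[of g k 1] by simp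
  then have "fls_nth g m = 0" if "m > 0" for m
  proof -
    have "m = int (nat (m - 1)) + 1" using that by simp
    then show ?thesis using \<open>\<And>k. fls_nth g (int k + 1) = 0\<close> by metis
  qed
  then obtain b where b: "g = poly_lser b"
    using poly_lsers_iff[of g] by (auto simp: poly_lsers_def)
  define c' where "c' j = (if j = 0 then - b else c j)" for j
  have "poly_lser (c' 0) + (\<Sum>j=1..d. poly_lser (c' j) * f j) = - poly_lser b + g"
    by (simp add: c'_def g_def poly_lser.hom_uminus)
  also have "\<dots> = 0" by (simp add: b)
  finally have c': "\<forall>j\<le>d. c' j = 0"
    by (rule indep[unfolded lin_indep_one_over_Kz_iff_poly, THEN spec[of _ c'], THEN mp])
  have "v $ r = 0" if r: "r < D" for r
  proof -
    have "0 = coeff (c (r mod d + 1)) (r div d)"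
      using c'[rule_format, of "r mod d + 1"] d by (simp add: c'_def Suc_le_eq)
    also have "\<dots> = (\<Sum>s | s < D \<and> s mod d = r mod d. if s = r then v $ s else 0)"
      unfolding c_def coeff_sum coeff_monom
    proof (rule sum.cong)
      fix s assume "s \<in> {s. s < D \<and> s mod d = r mod d}"
      then have "s div d = r div d \<longleftrightarrow> s = r" by auto (metis div_mult_mod_eq)
      then show "(if s div d = r div d then v $ s else 0) = (if s = r then v $ s else 0)" by simp
    qed auto
    also have "\<dots> = v $ r" using r by simp
    finally show ?thesis by simp
  qed
  then have "v = 0\<^sub>v D" using v(1) by (intro eq_vecI) auto
  with v(2) show False by simp
qed

section \<open>Relations between the series annihilate the determinant\<close>

text \<open>
  The polynomial \<open>c\<^sub>0 P\<^sub>l + \<Sum>\<^sub>j c\<^sub>j Q\<^sub>j\<^sub>,\<^sub>l\<close> differs by \<open>P\<^sub>l\<close> times the relation from the combination of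
  the remainders with coefficients \<open>c\<^sub>j\<close>. Multiplication by \<open>c\<^sub>j\<close> raises the powers of \<open>z\<close> by less
  than \<open>n\<close>, and the remainders have order at least \<open>n+1\<close> in \<open>1/z\<close>. So the polynomial has only
  negative powers of \<open>z\<close>, hence is zero, and \<open>(c\<^sub>0, \<dots>, c\<^sub>d)\<close> is a left kernel vector.
\<close>

lemma pade_relation_det_eq_0:
  fixes c :: "nat \<Rightarrow> 'a::field poly"
  assumes rel: "poly_lser (c 0) + (\<Sum>j=1..d. poly_lser (c j) * f j) = 0"
    and c: "j\<^sub>0 \<le> d" "c j\<^sub>0 \<noteq> 0"
    and degc: "\<And>j. j \<le> d \<Longrightarrow> degree (c j) < n"
    and neg: "\<And>i. 1 \<le> i \<Longrightarrow> i \<le> d \<Longrightarrow> f i \<in> neg_lser"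
    and orth: "\<And>i k l. 1 \<le> i \<Longrightarrow> i \<le> d \<Longrightarrow> k < n \<Longrightarrow> l \<le> d \<Longrightarrow>
      res_pairing (f i) (monom 1 k * P l) = 0"
  shows "det (mat (d + 1) (d + 1) (\<lambda>(i, l). if i = 0 then P l else phi (f i) (diff_quot (P l)))) = 0"
    (is "det ?M = 0")
proof -
  have M: "?M \<in> carrier_mat (d + 1) (d + 1)" by simp
  have kill: "c 0 * P l + (\<Sum>j=1..d. c j * phi (f j) (diff_quot (P l))) = 0" (is "?q = 0")
    if l: "l \<le> d" for l
  proof (rule poly_eqI)
    fix m
    have rem: "fls_nth (pade_rem (f j) (P l)) r = 0" if "1 \<le> j" "j \<le> d" "r \<le> int n" for j r
      using that l by (simp add: fls_nth_pade_rem neg orth)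
    have "poly_lser ?q = poly_lser ?q -
        poly_lser (P l) * (poly_lser (c 0) + (\<Sum>j=1..d. poly_lser (c j) * f j))"
      by (simp only: rel mult_zero_right diff_zero)
    also have "\<dots> = (\<Sum>j=1..d. poly_lser (c j) * pade_rem (f j) (P l))"
      by (simp add: pade_rem_def poly_lser_add poly_lser_mult poly_lser.hom_sum algebra_simps
          sum_distrib_left sum_subtractf)
    finally have "fls_nth (poly_lser ?q) (- int m) =
        (\<Sum>j=1..d. \<Sum>k\<le>degree (c j). coeff (c j) k * fls_nth (pade_rem (f j) (P l)) (- int m + int k))"
      by (simp only: fls_nth_sum fls_nth_poly_lser_mult[OF order.refl])
    also have "\<dots> = 0"
    proof (intro sum.neutral ballI)
      fix j k assume "j \<in> {1..d}" "k \<in> {..degree (c j)}"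
      then show "coeff (c j) k * fls_nth (pade_rem (f j) (P l)) (- int m + int k) = 0"
        using degc[of j] by (simp add: rem)
    qed
    finally show "coeff ?q m = coeff 0 m"
      by (simp add: fls_nth_poly_lser)
  qed
  have "transpose_mat ?M *\<^sub>v vec (d + 1) c = 0\<^sub>v (d + 1)"
  proof (rule eq_vecI)
    fix l assume "l < dim_vec (0\<^sub>v (d + 1) :: 'a poly vec)"
    then have l: "l \<le> d" by simp
    have "vec_index (transpose_mat ?M *\<^sub>v vec (d + 1) c) l =
        (\<Sum>i=0..d. c i * (if i = 0 then P l else phi (f i) (diff_quot (P l))))"
      using l by (simp add: scalar_prod_def atLeastLessThanSuc_atLeastAtMost mult.commute
          del: sum.op_ivl_Suc)
    also have "\<dots> = c 0 * P l + (\<Sum>j=1..d. c j * phi (f j) (diff_quot (P l)))"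
      by (simp add: sum.atLeast_Suc_atMost)
    finally show "vec_index (transpose_mat ?M *\<^sub>v vec (d + 1) c) l = vec_index (0\<^sub>v (d + 1)) l"
      using kill[OF l] l by simp
  qed simp
  moreover have "vec (d + 1) c \<noteq> 0\<^sub>v (d + 1)"
  proof
    assume "vec (d + 1) c = 0\<^sub>v (d + 1)"
    then have "vec_index (vec (d + 1) c) j\<^sub>0 = vec_index (0\<^sub>v (d + 1)) j\<^sub>0" by simp
    with c show False by simp
  qed
  ultimately have "det (transpose_mat ?M) = 0"
    by (intro det_0_iff_vec_prod_zero[of _ "d + 1", THEN iffD2] exI[of _ "vec (d + 1) c"]) auto
  then show ?thesis
    by (simp only: det_transpose[OF M])
qed

section \<open>The equivalence\<close>

lemma lin_comb_eq_0_distinct_degrees: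
  fixes P :: "nat \<Rightarrow> 'a::field poly"
  assumes deg: "\<And>l. l \<le> d \<Longrightarrow> degree (P l) = D + l" and nz: "\<And>l. l \<le> d \<Longrightarrow> P l \<noteq> 0"
    and zero: "(\<Sum>l\<le>d. Polynomial.smult (v l) (P l)) = 0" and l: "l \<le> d"
  shows "v l = 0"
proof (rule ccontr)
  assume "v l \<noteq> 0"
  define t where "t = Max {l. l \<le> d \<and> v l \<noteq> 0}"
  have fin: "finite {l. l \<le> d \<and> v l \<noteq> 0}" by simp
  have t: "t \<le> d" "v t \<noteq> 0"
    using Max_in[OF fin] l \<open>v l \<noteq> 0\<close> unfolding t_def by blast+
  have above: "v s = 0" if "s \<le> d" "t < s" for s
  proof (rule ccontr)
    assume "v s \<noteq> 0"
    then have "s \<le> t" unfolding t_def using that(1) by (intro Max_ge fin) simp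
    with that(2) show False by simp
  qed
  have "0 = (\<Sum>s\<le>d. v s * coeff (P s) (D + t))"
    using arg_cong[OF zero, of "\<lambda>p. coeff p (D + t)"] by (simp add: coeff_sum)
  also have "\<dots> = (\<Sum>s\<le>d. if s = t then v s * coeff (P s) (D + t) else 0)"
  proof (intro sum.cong refl)
    fix s assume "s \<in> {..d}"
    then have "v s = 0 \<or> degree (P s) < D + t" if "s \<noteq> t"
      using that above[of s] deg[of s] by (cases "s < t") auto
    then show "v s * coeff (P s) (D + t) = (if s = t then v s * coeff (P s) (D + t) else 0)"
      by (auto simp: coeff_eq_0)
  qed
  also have "\<dots> = v t * lead_coeff (P t)"
    using t deg[of t] by simp
  finally show False using t nz[of t] by simp
qed

theorem proposition6p1:
  fixes L :: "'a::field_char_0 weyl"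
    and d :: nat
    and f :: "nat \<Rightarrow> 'a fls"
    and R :: "nat \<Rightarrow> 'a weyl"
  assumes "L \<noteq> 0"
    and "weyl_ord L = int d"
    and "d \<ge> 1"
    and "property_P L"
    and "inj_on f {1..d}"
    and "lser.independent (f ` {1..d})"
    and "lser.span (f ` {1..d}) = V1 L"
    and "\<And>n. n \<ge> 1 \<Longrightarrow> R n \<in> In n L - {0}"
    and "\<And>n. n \<ge> 1 \<Longrightarrow> weyl_ord (R n) = int (d * n)"
    and "\<And>n. n \<ge> 1 \<Longrightarrow> property_P (R n)"
  shows "lin_indep_one_over_Kz d f \<longleftrightarrow>
    (\<forall>n\<ge>1. \<exists>c::'a. c \<noteq> 0 \<and> pade_det d (R n) f = [:c:])"
proof -
  have f_V1: "f i \<in> V1 L" if "1 \<le> i" "i \<le> d" for i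
  proof -
    have "f i \<in> lser.span (f ` {1..d})"
      by (rule lser.span_base) (use that in auto)
    then show ?thesis by (simp only: assms(7))
  qed
  then have neg: "f i \<in> neg_lser" if "1 \<le> i" "i \<le> d" for i
    using that by (auto simp: V1_def)
  have orth: "res_pairing (f i) (monom 1 k * pade_P (R n) l) = 0"
    if "1 \<le> n" "1 \<le> i" "i \<le> d" "k < n" for n i k l
    unfolding pade_P_def using that assms(8) f_V1 by (intro In_orthogonal[of _ n L]) auto
  have deg: "degree (pade_P (R n) l) = d * n + l" if "1 \<le> n" for n l
    using that assms(9,10) by (intro degree_pade_P) auto
  have nz: "pade_P (R n) l \<noteq> 0" if "1 \<le> n" for n l
    using deg[OF that, of l] that assms(3) by auto
  define N where "N n = mat (d + 1) (d + 1) (\<lambda>(i, l). if i = 0 then coeff (pade_P (R n) l) (d * n + d)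
         else - res_pairing (f i) (monom 1 n * pade_P (R n) l))" for n
  have const: "pade_det d (R n) f = [:det (N n):]" if n: "1 \<le> n" for n
    unfolding pade_det_def pade_Q_def N_def
    by (rule det_pade_eq_const) (use n in \<open>simp_all add: deg neg orth\<close>)
  show ?thesis
  proof
    assume indep: "lin_indep_one_over_Kz d f"
    have "det (N n) \<noteq> 0" if n: "1 \<le> n" for n
    proof
      assume "det (N n) = 0"
      moreover have "N n \<in> carrier_mat (d + 1) (d + 1)" by (simp add: N_def)
      ultimately obtain v where v: "v \<in> carrier_vec (d + 1)" "v \<noteq> 0\<^sub>v (d + 1)"
          "N n *\<^sub>v v = 0\<^sub>v (d + 1)"
        using det_0_iff_vec_prod_zero by blast
      \<comment> \<open>The first row of \<open>N n\<close> removes the term of degree \<open>dn + d\<close> from the combination \<open>p\<close>; the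
        other rows are the additional relations of level \<open>n + 1\<close>.\<close>
      define p where "p = (\<Sum>l\<le>d. Polynomial.smult (vec_index v l) (pade_P (R n) l))"
      have row: "(\<Sum>l\<le>d. vec_index v l * N n $$ (i, l)) = 0" if "i \<le> d" for i
      proof -
        have "(\<Sum>l\<le>d. vec_index v l * N n $$ (i, l)) = vec_index (N n *\<^sub>v v) i"
          using that v(1)
          by (simp add: N_def scalar_prod_def atLeast0LessThan lessThan_Suc_atMost mult.commute
              del: sum.lessThan_Suc)
        then show ?thesis using v(3) that by simp
      qed
      have "coeff p (d * n + d) = 0"
        using row[of 0] by (simp add: p_def coeff_sum N_def)
      moreover have "degree p \<le> d * n + d"
        unfolding p_def
        by (intro degree_sum_le) (auto simp: deg[OF n])
      ultimately have degp: "degree p < d * n + d \<or> p = 0"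
        by (metis leading_coeff_0_iff le_neq_implies_less)
      have "p = 0"
      proof (rule ccontr)
        assume "p \<noteq> 0"
        have "p = 0"
        proof (rule orthogonal_low_degree_eq_0[OF indep, where N = "n + 1"])
          show "degree (pade_P (R (n + 1)) l) = d * (n + 1) + l" for l
            by (rule deg) simp
          show "degree p < d * (n + 1)"
            using degp \<open>p \<noteq> 0\<close> by simp
          show "res_pairing (f i) (monom 1 k * p) = 0" if i: "1 \<le> i" "i \<le> d" and "k < n + 1" for i k
          proof (cases "k = n")
            case True
            have "- res_pairing (f i) (monom 1 n * p) = (\<Sum>l\<le>d. vec_index v l * N n $$ (i, l))"
              using i by (simp add: p_def N_def sum_distrib_left res_pairing_sum
                  res_pairing_smult sum_negf)
            with row[OF i(2)] True show ?thesis by simp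
          next
            case False
            with \<open>k < n + 1\<close> have "k < n" by simp
            then show ?thesis
              using i n by (simp add: p_def sum_distrib_left res_pairing_sum res_pairing_smult orth)
          qed
        qed (simp_all add: nz orth)
        with \<open>p \<noteq> 0\<close> show False by contradiction
      qed
      then have "vec_index v l = 0" if "l \<le> d" for l
        using that unfolding p_def
        by (intro lin_comb_eq_0_distinct_degrees[where P = "pade_P (R n)" and D = "d * n"])
          (simp_all add: deg[OF n] nz[OF n])
      then have "v = 0\<^sub>v (d + 1)"
        using v(1) by (intro eq_vecI) auto
      with v(2) show False by contradiction
    qed
    then show "\<forall>n\<ge>1. \<exists>c::'a. c \<noteq> 0 \<and> pade_det d (R n) f = [:c:]"
      using const by blast
  next
    assume det: "\<forall>n\<ge>1. \<exists>c::'a. c \<noteq> 0 \<and> pade_det d (R n) f = [:c:]"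
    show "lin_indep_one_over_Kz d f"
      unfolding lin_indep_one_over_Kz_iff_poly
    proof (intro allI impI)
      fix c j
      assume rel: "poly_lser (c 0) + (\<Sum>j=1..d. poly_lser (c j) * f j) = 0" and j: "j \<le> d"
      \<comment> \<open>One level \<open>n\<close> above the degrees of all coefficients is enough for a contradiction.\<close>
      define n where "n = Suc (Max ((\<lambda>j. degree (c j)) ` {..d}))"
      have n: "1 \<le> n" by (simp add: n_def)
      show "c j = 0"
      proof (rule ccontr)
        assume "c j \<noteq> 0"
        have "pade_det d (R n) f = 0"
          unfolding pade_det_def pade_Q_def
        proof (rule pade_relation_det_eq_0[OF rel j \<open>c j \<noteq> 0\<close>])
          show "degree (c i) < n" if "i \<le> d" for i
            unfolding n_def less_Suc_eq_le using that by (intro Max_ge) auto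
        qed (use n in \<open>simp_all add: neg orth\<close>)
        with det n show False by force
      qed
    qed
  qed
qed

end
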